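(* Let $X$ be an abelian Polish group (written additively). If $A\subset X$ is a Borel set which is not Haar meager, then $0\in \mathrm{int}\,(A-A)$, where $A-A=\{a-b : a,b\in A\}$ and $\mathrm{int}$ denotes the topological interior in $X$.
   Context: An abelian Polish group is a topological abelian group whose topology is induced by a complete separable metric. A set $A\subset X$ in an abelian Polish group $X$ is called Haar meager if there exist a Borel set $B\subset X$ with $A\subset B$, a (nonempty) compact metric space $K$ and a continuous function $f:K\to X$ such that $f^{-1}(B+x)$ is meager in $K$ for all $x\in X$. Here $B+x=\{b+x: b\in B\}$. *)

theory Defs
  imports "HOL-Analysis.Analysis"
begin

definition nowhere_dense_in :: "'a topology \<Rightarrow> 'a set \<Rightarrow> bool" where
  "nowhere_dense_in T S \<longleftrightarrow> S \<subseteq> topspace T \<and> T interior_of (T closure_of S) = {}"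

definition meager_in :: "'a topology \<Rightarrow> 'a set \<Rightarrow> bool" where
  "meager_in T S \<longleftrightarrow> (\<exists>N :: nat \<Rightarrow> 'a set. (\<forall>n. nowhere_dense_in T (N n)) \<and> S = (\<Union>n. N n))"

text \<open>
  The witness \<open>K\<close> ranges over all nonempty compact metric spaces, up to isometry. HOL cannot
  quantify over types inside a definition, so the points of \<open>K\<close> are taken from the type
  \<open>nat \<Rightarrow> real\<close>, with an arbitrary carrier and an arbitrary metric on it (unrelated to any metric
  or topology of the type). This loses nothing: if \<open>q\<close> is a dense sequence in a compact
  metric space, then mapping \<open>x\<close> to the sequence of its distances to \<open>q\<close> is injective.
  Lemma \<open>haar_meagerI\<close> below derives the property from a witness over an arbitrary type.
\<close>

definition haar_meager :: "'a::{topological_ab_group_add, polish_space} set \<Rightarrow> bool" where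
  "haar_meager A \<longleftrightarrow>
    (\<exists>B \<in> sets borel. A \<subseteq> B \<and>
      (\<exists>(K :: (nat \<Rightarrow> real) metric) f.
        mspace K \<noteq> {} \<and> compact_space (mtopology_of K) \<and>
        continuous_map (mtopology_of K) euclidean f \<and>
        (\<forall>x. meager_in (mtopology_of K) {k \<in> mspace K. f k \<in> (\<lambda>b. b + x) ` B})))"

lemma meager_in_homeomorphic_image:
  assumes h: "homeomorphic_map T U h" and S: "meager_in T S"
  shows "meager_in U (h ` S)"
proof -
  obtain N :: "nat \<Rightarrow> _ set" where N: "\<And>n. nowhere_dense_in T (N n)" and SN: "S = (\<Union>n. N n)"
    using S by (auto simp: meager_in_def)
  have "nowhere_dense_in U (h ` N n)" for n
  proof -
    have sub: "N n \<subseteq> topspace T" and e: "T interior_of (T closure_of N n) = {}"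
      using N[of n] by (auto simp: nowhere_dense_in_def)
    have "U interior_of (U closure_of (h ` N n)) = h ` (T interior_of (T closure_of N n))"
      using homeomorphic_map_closure_of[OF h sub]
        homeomorphic_map_interior_of[OF h closure_of_subset_topspace] by metis
    moreover have "h ` N n \<subseteq> topspace U"
      using h sub homeomorphic_imp_surjective_map by blast
    ultimately show ?thesis
      using e by (simp add: nowhere_dense_in_def)
  qed
  then show ?thesis
    unfolding meager_in_def SN by (intro exI[of _ "\<lambda>n. h ` N n"]) auto
qed

lemma compact_metric_dense_sequence:
  fixes K :: "'k metric"
  assumes ne: "mspace K \<noteq> {}" and cpt: "compact_space (mtopology_of K)"
  obtains q :: "nat \<Rightarrow> 'k" where "range q \<subseteq> mspace K"
    and "\<And>x e. x \<in> mspace K \<Longrightarrow> e > 0 \<Longrightarrow> \<exists>n. mdist K x (q n) < e"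
proof -
  interpret M: Metric_space "mspace K" "mdist K"
    by (rule Metric_space_mspace_mdist)
  have "M.mtotally_bounded (mspace K)"
    using cpt M.compactin_imp_mtotally_bounded[of "mspace K"]
    by (simp add: compact_space_def mtopology_of_def)
  then have "\<forall>n::nat. \<exists>F. finite F \<and> F \<subseteq> mspace K \<and> mspace K \<subseteq> (\<Union>x\<in>F. M.mball x (1 / Suc n))"
    unfolding M.mtotally_bounded_def by simp
  then obtain F where F: "\<And>n::nat. finite (F n)" "\<And>n. F n \<subseteq> mspace K"
      "\<And>n. mspace K \<subseteq> (\<Union>x\<in>F n. M.mball x (1 / Suc n))"
    by metis
  define D where "D = (\<Union>n. F n)"
  have "countable D"
    using F(1) by (simp add: D_def countable_finite)
  moreover have "D \<noteq> {}"
    unfolding D_def using F(3)[of 0] ne by blast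
  ultimately have r: "range (from_nat_into D) = D"
    by (rule range_from_nat_into[rotated])
  show thesis
  proof
    show "range (from_nat_into D) \<subseteq> mspace K"
      using F(2) unfolding r by (auto simp: D_def)
    fix x e assume "x \<in> mspace K" "(e::real) > 0"
    obtain n where n: "1 / Suc n < e"
      using \<open>e > 0\<close> by (rule nat_approx_posE)
    have "x \<in> (\<Union>y\<in>F n. M.mball y (1 / Suc n))"
      using F(3) \<open>x \<in> mspace K\<close> by (rule subsetD)
    then obtain y where "y \<in> F n" "mdist K y x < 1 / Suc n"
      by (auto simp del: of_nat_Suc)
    then have "mdist K x y < e" "y \<in> range (from_nat_into D)"
      using n unfolding r by (auto simp: D_def M.commute)
    then show "\<exists>n. mdist K x (from_nat_into D n) < e"
      by auto
  qed
qed

lemma haar_meagerI: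
  fixes A B :: "'a::{topological_ab_group_add, polish_space} set" and K :: "'k metric"
  assumes B: "B \<in> sets borel" "A \<subseteq> B"
    and ne: "mspace K \<noteq> {}" and cpt: "compact_space (mtopology_of K)"
    and f: "continuous_map (mtopology_of K) euclidean f"
    and meager: "\<And>x. meager_in (mtopology_of K) {k \<in> mspace K. f k \<in> (\<lambda>b. b + x) ` B}"
  shows "haar_meager A"
proof -
  interpret M: Metric_space "mspace K" "mdist K"
    by (rule Metric_space_mspace_mdist)
  obtain q :: "nat \<Rightarrow> 'k" where q: "range q \<subseteq> mspace K"
    and dense: "\<And>x e. x \<in> mspace K \<Longrightarrow> e > 0 \<Longrightarrow> \<exists>n. mdist K x (q n) < e"
    using compact_metric_dense_sequence[OF ne cpt] by blast
  define h where "h x = (\<lambda>n. mdist K x (q n))" for x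
  have inj: "inj_on h (mspace K)"
  proof (rule inj_onI, rule ccontr)
    fix x y assume xy: "x \<in> mspace K" "y \<in> mspace K" "h x = h y" "x \<noteq> y"
    then obtain n where n: "mdist K x (q n) < mdist K x y / 2"
      using dense[of x "mdist K x y / 2"] by auto
    have "mdist K x y \<le> mdist K x (q n) + mdist K y (q n)"
      using xy q by (intro M.triangle') auto
    also have "mdist K y (q n) = mdist K x (q n)"
      using xy(3) by (metis h_def)
    finally show False
      using n by simp
  qed
  define g where "g = the_inv_into (mspace K) h"
  have gh: "g (h x) = x" if "x \<in> mspace K" for x
    unfolding g_def using inj that by (rule the_inv_into_f_f)
  define d where "d u v = mdist K (g u) (g v)" for u v
  have ms: "Metric_space (h ` mspace K) d"
  proof
    show "0 \<le> d u v" "d u v = d v u" for u v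
      by (simp_all add: d_def M.commute)
    show "d u v = 0 \<longleftrightarrow> u = v" if "u \<in> h ` mspace K" "v \<in> h ` mspace K" for u v
      using that by (auto simp: d_def gh)
    show "d u w \<le> d u v + d v w"
      if "u \<in> h ` mspace K" "v \<in> h ` mspace K" "w \<in> h ` mspace K" for u v w
      using that by (auto simp: d_def gh M.triangle)
  qed
  define L where "L = metric (h ` mspace K, d)"
  have L: "mspace L = h ` mspace K" "mdist L = d"
    unfolding L_def using ms
    by (simp_all add: Metric_space.mspace_metric Metric_space.mdist_metric)
  interpret MM: Metric_space12 "mspace K" "mdist K" "mspace L" "mdist L"
    by (intro Metric_space12.intro Metric_space_mspace_mdist)
  have hom: "homeomorphic_map (mtopology_of K) (mtopology_of L) h"
    unfolding mtopology_of_def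
    by (rule MM.isometry_imp_homeomorphic_map) (auto simp: L d_def gh)
  then obtain h' where hh': "homeomorphic_maps (mtopology_of K) (mtopology_of L) h h'"
    using homeomorphic_map_maps by blast
  have "compact_space (mtopology_of L)"
    using hom cpt homeomorphic_compact_space homeomorphic_map_imp_homeomorphic_space by blast
  moreover have "continuous_map (mtopology_of L) euclidean (f \<circ> h')"
    using hh' f by (auto simp: homeomorphic_maps_def intro: continuous_map_compose)
  moreover have "meager_in (mtopology_of L) {k \<in> mspace L. (f \<circ> h') k \<in> (\<lambda>b. b + x) ` B}" for x
  proof -
    have "h' (h k) = k" if "k \<in> mspace K" for k
      using hh' that by (auto simp: homeomorphic_maps_def)
    then have "{k \<in> mspace L. (f \<circ> h') k \<in> (\<lambda>b. b + x) ` B}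
        = h ` {k \<in> mspace K. f k \<in> (\<lambda>b. b + x) ` B}"
      by (auto simp: L)
    then show ?thesis
      using meager_in_homeomorphic_image[OF hom meager[of x]] by simp
  qed
  moreover have "mspace L \<noteq> {}"
    using ne by (simp add: L)
  ultimately show ?thesis
    unfolding haar_meager_def using B by blast
qed

end

theory Submission
  imports Defs
begin

text \<open>
  The Haar meager witness is a Cantor cube of subsums. If \<open>0\<close> is not interior to \<open>A - A\<close>, there
  are points \<open>x n \<notin> A - A\<close> that tend to \<open>0\<close> as fast as desired
  (\<open>exists_rapidly_vanishing_sequence\<close>), in particular so fast that every subseries converges
  and \<open>f \<alpha>\<close>, the sum of all \<open>x n\<close> with \<open>\<alpha> n\<close>, is continuous on the compact space of
  0-1 sequences (\<open>subsum_limit\<close>). Switching one coordinate \<open>n\<close> of \<open>\<alpha>\<close> changes \<open>f \<alpha>\<close> by exactly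
  \<open>x n\<close> or \<open>- x n\<close>. So the preimage under \<open>f\<close> of a translate of \<open>A\<close> never contains two
  sequences that differ in exactly one place: otherwise \<open>x n\<close> or \<open>- x n\<close>, and then both by
  symmetry, would be a difference of points of \<open>A\<close>.

  Such a preimage is meager. It is Borel and hence has the Baire property
  (\<open>borel_imp_baire_property\<close>), and a nonmeager set with the Baire property does contain
  two sequences that differ in exactly one place (\<open>nonmeager_imp_flip_pair\<close>), much as a set of
  positive measure contains small differences. Hence \<open>f\<close> shows that \<open>A\<close> is Haar meager.
\<close>

section \<open>Meager sets and the Baire property\<close>

lemma meager_in_subset:
  assumes "meager_in T S" "S' \<subseteq> S"
  shows "meager_in T S'"
proof -
  obtain N :: "nat \<Rightarrow> _ set" where N: "\<And>n. nowhere_dense_in T (N n)" and S: "S = (\<Union>n. N n)"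
    using assms(1) by (auto simp: meager_in_def)
  have "nowhere_dense_in T (N n \<inter> S')" for n
    using N[of n] interior_of_mono[OF closure_of_mono[of "N n \<inter> S'" "N n" T], of T]
    by (auto simp: nowhere_dense_in_def)
  moreover have "S' = (\<Union>n. N n \<inter> S')"
    using assms(2) S by blast
  ultimately show ?thesis
    unfolding meager_in_def by (intro exI[of _ "\<lambda>n. N n \<inter> S'"]) auto
qed

lemma nowhere_dense_in_imp_meager_in: "nowhere_dense_in T S \<Longrightarrow> meager_in T S"
  unfolding meager_in_def by (intro exI[of _ "\<lambda>_. S"]) auto

lemma meager_in_empty: "meager_in T {}"
  by (rule nowhere_dense_in_imp_meager_in) (simp add: nowhere_dense_in_def)

lemma meager_in_UN:
  fixes S :: "nat \<Rightarrow> 'a set"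
  assumes "\<And>i. meager_in T (S i)"
  shows "meager_in T (\<Union>i. S i)"
proof -
  have "\<forall>i. \<exists>N :: nat \<Rightarrow> _ set. (\<forall>n. nowhere_dense_in T (N n)) \<and> S i = (\<Union>n. N n)"
    using assms by (simp add: meager_in_def)
  then obtain N :: "nat \<Rightarrow> nat \<Rightarrow> _ set"
    where N: "\<And>i n. nowhere_dense_in T (N i n)" and S: "\<And>i. S i = (\<Union>n. N i n)"
    by metis
  define N' where "N' m = N (fst (prod_decode m)) (snd (prod_decode m))" for m
  have "(\<Union>i. S i) = (\<Union>m. N' m)"
  proof (intro equalityI subsetI)
    fix x assume "x \<in> (\<Union>i. S i)"
    then obtain i n where "x \<in> N i n"
      using S by auto
    then have "x \<in> N' (prod_encode (i, n))"
      by (simp add: N'_def)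
    then show "x \<in> (\<Union>m. N' m)"
      by blast
  qed (auto simp: N'_def S)
  moreover have "nowhere_dense_in T (N' m)" for m
    using N by (simp add: N'_def)
  ultimately show ?thesis
    by (auto simp: meager_in_def)
qed

lemma meager_in_Un:
  assumes "meager_in T S" "meager_in T S'"
  shows "meager_in T (S \<union> S')"
proof -
  have "S \<union> S' = (\<Union>i::nat. if i = 0 then S else S')"
    by (auto split: if_splits)
  then show ?thesis
    using meager_in_UN[of T "\<lambda>i::nat. if i = 0 then S else S'"] assms by auto
qed

lemma frontier_of_open_nowhere_dense:
  fixes U :: "'a::topological_space set"
  assumes "open U"
  shows "nowhere_dense_in euclidean (frontier U)"
proof -
  \<comment> \<open>An open set that misses \<open>U\<close> also misses its closure, which contains the frontier.\<close>
  let ?V = "interior (frontier U)"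
  have sub: "?V \<subseteq> closure U" "?V \<inter> U = {}"
    using interior_subset[of "frontier U"] assms by (auto simp: frontier_def interior_open)
  then have "?V \<inter> closure U = {}"
    by (simp add: open_Int_closure_eq_empty)
  with sub(1) have "?V = {}"
    by blast
  then show ?thesis
    by (simp add: nowhere_dense_in_def)
qed

text \<open>
  The sets that agree with an open set up to a meager one form a \<open>\<sigma>\<close>-algebra. Only complements
  take an idea: if \<open>S\<close> goes with the open set \<open>U\<close>, then \<open>- S\<close> goes with the exterior of \<open>U\<close>, and
  the frontier of \<open>U\<close>, which is lost in this way, is nowhere dense.
\<close>

lemma borel_imp_baire_property:
  fixes S :: "'a::topological_space set"
  assumes "S \<in> sets borel"
  shows "\<exists>U. open U \<and> meager_in euclidean (sym_diff S U)"
  using assms unfolding sets_borel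
proof (induction rule: sigma_sets.induct)
  case (Basic U)
  then show ?case
    by (intro exI[of _ U]) (simp add: meager_in_empty)
next
  case Empty
  show ?case
    by (intro exI[of _ "{}"]) (simp add: meager_in_empty)
next
  case (Compl S)
  then obtain U where U: "open U" "meager_in euclidean (sym_diff S U)"
    by blast
  have "meager_in euclidean (frontier U)"
    using U(1) by (intro nowhere_dense_in_imp_meager_in frontier_of_open_nowhere_dense)
  then have "meager_in euclidean (sym_diff S U \<union> frontier U)"
    using U(2) by (rule meager_in_Un[rotated])
  moreover have "sym_diff (UNIV - S) (- closure U) \<subseteq> sym_diff S U \<union> frontier U"
    using U(1) closure_subset[of U] by (auto simp: frontier_def interior_open)
  ultimately have "meager_in euclidean (sym_diff (UNIV - S) (- closure U))"
    by (rule meager_in_subset)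
  then show ?case
    by (intro exI[of _ "- closure U"] conjI open_Compl closed_closure)
next
  case (Union S)
  then obtain U where U: "\<And>i. open (U i)" "\<And>i. meager_in euclidean (sym_diff (S i) (U i))"
    by metis
  have "sym_diff (\<Union>i. S i) (\<Union>i. U i) \<subseteq> (\<Union>i. sym_diff (S i) (U i))"
    by blast
  then have "meager_in euclidean (sym_diff (\<Union>i. S i) (\<Union>i. U i))"
    using meager_in_UN[OF U(2)] by (rule meager_in_subset[rotated])
  then show ?case
    using U(1) by (intro exI[of _ "\<Union>i. U i"]) auto
qed

lemma open_meager_in_imp_empty:
  assumes cpt: "compact_space T" and haus: "Hausdorff_space T"
    and U: "openin T U" "meager_in T U"
  shows "U = {}"
proof -
  obtain N :: "nat \<Rightarrow> _ set" where N: "\<And>n. nowhere_dense_in T (N n)" and UN: "U = (\<Union>n. N n)"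
    using U(2) by (auto simp: meager_in_def)
  have "T interior_of \<Union>(range (\<lambda>n. T closure_of N n)) = {}"
  proof (rule Baire_category_alt)
    show "completely_metrizable_space T \<or> locally_compact_space T \<and> regular_space T"
      using cpt haus compact_imp_locally_compact_space compact_Hausdorff_imp_regular_space by blast
  qed (use N in \<open>auto simp: nowhere_dense_in_def\<close>)
  moreover have "U \<subseteq> \<Union>(range (\<lambda>n. T closure_of N n))"
  proof -
    have "N n \<subseteq> T closure_of N n" for n
      using N[of n] by (intro closure_of_subset) (simp add: nowhere_dense_in_def)
    then show ?thesis
      unfolding UN by (rule UN_mono[OF order_refl])
  qed
  ultimately show ?thesis
    using interior_of_maximal[OF _ U(1)] by (metis subset_empty)
qed

section \<open>Flipping coordinates of the Cantor space\<close>

lemma compact_space_cantor: "compact_space (euclidean :: (nat \<Rightarrow> bool) topology)"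
proof -
  have "compact_space (euclidean :: bool topology)"
    by (simp add: compact_space_def finite_imp_compact)
  then have "compact_space (product_topology (\<lambda>i::nat. euclidean :: bool topology) UNIV)"
    by (simp add: compact_space_product_topology)
  then show ?thesis
    by (simp add: euclidean_product_topology)
qed

lemma metrizable_space_cantor: "metrizable_space (euclidean :: (nat \<Rightarrow> bool) topology)"
proof -
  have "(euclidean :: bool topology) = discrete_topology UNIV"
    by (simp add: topology_eq open_discrete)
  then have "metrizable_space (product_topology (\<lambda>i::nat. euclidean :: bool topology) UNIV)"
    by (auto simp: metrizable_space_product_topology)
  then show ?thesis
    by (simp add: euclidean_product_topology)
qed

definition flip :: "nat \<Rightarrow> (nat \<Rightarrow> bool) \<Rightarrow> nat \<Rightarrow> bool" where
  "flip n \<alpha> = \<alpha>(n := \<not> \<alpha> n)"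

lemma flip_flip [simp]: "flip n (flip n \<alpha>) = \<alpha>"
  by (simp add: flip_def)

lemma continuous_on_flip: "continuous_on UNIV (flip n)"
proof (rule continuous_on_coordinatewise_then_product)
  fix i
  have "continuous_on UNIV (\<lambda>\<alpha> :: nat \<Rightarrow> bool. \<not> \<alpha> n)"
    by (rule continuous_on_compose2[of UNIV Not]) auto
  then show "continuous_on UNIV (\<lambda>\<alpha>. flip n \<alpha> i)"
    by (cases "i = n") (auto simp: flip_def)
qed

lemma homeomorphic_map_flip: "homeomorphic_map euclidean euclidean (flip n)"
proof -
  have "homeomorphic_maps euclidean euclidean (flip n) (flip n)"
    by (simp add: homeomorphic_maps_def continuous_on_flip)
  then show ?thesis
    using homeomorphic_map_maps by blast
qed

lemma flip_tendsto: "(\<lambda>n. flip n \<alpha>) \<longlonglongrightarrow> \<alpha>"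
proof -
  have "\<forall>\<^sub>F n in sequentially. flip n \<alpha> i = \<alpha> i" for i
    using eventually_gt_at_top[of i] by eventually_elim (simp add: flip_def)
  then have "(\<lambda>n. flip n \<alpha> i) \<longlonglongrightarrow> \<alpha> i" for i
    by (rule tendsto_eventually)
  then have "limitin (product_topology (\<lambda>_. euclidean) UNIV) (\<lambda>n. flip n \<alpha>) \<alpha> sequentially"
    by (auto simp: limitin_componentwise)
  then show ?thesis
    by (simp add: euclidean_product_topology)
qed

text \<open>
  Modulo a meager set, \<open>S\<close> is an open set \<open>U\<close>, which is nonempty because \<open>S\<close> is not meager.
  If \<open>\<alpha> \<in> U\<close>, then \<open>flip n \<alpha> \<in> U\<close> for large \<open>n\<close>, so that the points which stay in
  \<open>U\<close> under \<open>flip n\<close> form a nonempty open set; by the Baire category theorem this set cannot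
  be covered by the two meager sets \<open>U - S\<close> and \<open>flip n ` (U - S)\<close>, and each of its points outside both
  belongs to \<open>S\<close> together with its flip.
\<close>

lemma nonmeager_imp_flip_pair:
  fixes S :: "(nat \<Rightarrow> bool) set"
  assumes S: "S \<in> sets borel" and nonmeager: "\<not> meager_in euclidean S"
  obtains n \<beta> where "\<beta> \<in> S" "flip n \<beta> \<in> S"
proof -
  obtain U where U: "open U" "meager_in euclidean (sym_diff S U)"
    using borel_imp_baire_property[OF S] by blast
  have "U \<noteq> {}"
    using U(2) nonmeager by auto
  then obtain \<alpha> where "\<alpha> \<in> U"
    by blast
  then have "\<forall>\<^sub>F n in sequentially. flip n \<alpha> \<in> U"
    using U(1) flip_tendsto topological_tendstoD by blast
  then obtain n where n: "flip n \<alpha> \<in> U"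
    by (meson eventually_happens sequentially_bot)
  define V where "V = U \<inter> flip n -` U"
  have "openin euclidean V"
    using U(1) continuous_on_flip[of n] by (auto simp: V_def intro: open_vimage)
  moreover have "V \<noteq> {}"
    using \<open>\<alpha> \<in> U\<close> n by (auto simp: V_def)
  ultimately have "\<not> meager_in euclidean V"
    using open_meager_in_imp_empty[OF compact_space_cantor, of V]
      metrizable_imp_Hausdorff_space[OF metrizable_space_cantor] by blast
  moreover have "meager_in euclidean ((U - S) \<union> flip n ` (U - S))"
  proof (rule meager_in_Un)
    show "meager_in euclidean (U - S)"
      using U(2) by (rule meager_in_subset) auto
    then show "meager_in euclidean (flip n ` (U - S))"
      by (rule meager_in_homeomorphic_image[OF homeomorphic_map_flip])
  qed
  ultimately obtain \<beta> where \<beta>: "\<beta> \<in> V" "\<beta> \<notin> U - S" "\<beta> \<notin> flip n ` (U - S)"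
    using meager_in_subset by blast
  have "flip n \<beta> \<notin> U - S"
    using \<beta>(3) by (metis flip_flip imageI)
  with \<beta> that show thesis
    by (auto simp: V_def)
qed

section \<open>Subsums of a rapidly vanishing sequence\<close>

definition subsum :: "(nat \<Rightarrow> 'a::comm_monoid_add) \<Rightarrow> nat \<Rightarrow> (nat \<Rightarrow> bool) \<Rightarrow> 'a" where
  "subsum x n \<alpha> = (\<Sum>i<n. if \<alpha> i then x i else 0)"

lemma subsum_Suc: "subsum x (Suc n) \<alpha> = subsum x n \<alpha> + (if \<alpha> n then x n else 0)"
  by (simp add: subsum_def)

lemma continuous_on_subsum:
  fixes x :: "nat \<Rightarrow> 'a::topological_comm_monoid_add"
  shows "continuous_on UNIV (subsum x n)"
proof -
  have "continuous_on UNIV (\<lambda>\<alpha> :: nat \<Rightarrow> bool. if \<alpha> i then x i else 0)" for i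
    by (rule continuous_on_compose2[of UNIV "\<lambda>b. if b then x i else 0"]) auto
  then show ?thesis
    unfolding subsum_def by (intro continuous_on_sum)
qed

lemma subsum_flip:
  fixes x :: "nat \<Rightarrow> 'a::ab_group_add"
  assumes "n < m"
  shows "subsum x m (flip n \<alpha>) - subsum x m \<alpha> = (if \<alpha> n then - x n else x n)"
proof -
  have "subsum x m (flip n \<alpha>) - subsum x m \<alpha>
      = (\<Sum>i<m. if i = n then (if \<alpha> n then - x n else x n) else 0)"
    unfolding subsum_def sum_subtractf[symmetric]
    by (rule sum.cong) (auto simp: flip_def)
  then show ?thesis
    using assms by simp
qed

text \<open>
  The metric need not be invariant under translations, so that small terms alone do not make
  the subsums converge. As there are only finitely many subsums of \<open>x 0, \<dots>, x (n - 1)\<close>, the next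
  term can be taken so small that it moves each of them by at most \<open>2\<^sup>-\<^sup>n\<close>.
\<close>

lemma exists_rapidly_vanishing_sequence:
  fixes D :: "'a::{topological_ab_group_add, metric_space} set"
  assumes D: "0 \<notin> interior D"
  obtains x :: "nat \<Rightarrow> 'a" where "\<And>n. x n \<notin> D"
    and "\<And>n \<alpha>. dist (subsum x n \<alpha> + x n) (subsum x n \<alpha>) < (1/2) ^ n"
proof -
  have step: "\<exists>y. y \<notin> D \<and> (\<forall>s\<in>F. dist (s + y) s < e)" if F: "finite F" and e: "e > 0" for F e
  proof -
    have "\<forall>\<^sub>F y in nhds 0. dist (s + y) s < e" for s :: 'a
    proof (rule tendstoD[OF _ e])
      have "((\<lambda>y. s + y) \<longlongrightarrow> s + 0) (nhds 0)"
        by (intro tendsto_intros) (simp add: filterlim_ident)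
      then show "((\<lambda>y. s + y) \<longlongrightarrow> s) (nhds 0)"
        by simp
    qed
    then have "\<forall>\<^sub>F y in nhds 0. \<forall>s\<in>F. dist (s + y) s < e"
      using F by (simp add: eventually_ball_finite)
    then obtain W where W: "open W" "0 \<in> W" "\<And>y. y \<in> W \<Longrightarrow> \<forall>s\<in>F. dist (s + y) s < e"
      unfolding eventually_nhds by blast
    have "\<not> W \<subseteq> D"
      using W(1,2) D interiorI by blast
    then show ?thesis
      using W(3) by blast
  qed
  \<comment> \<open>The choice of the next term depends on all earlier ones, but only through the finite set of
    their subsums; so the recursion is over these sets \<open>F n\<close>, and \<open>x n\<close> is recovered afterwards.\<close>
  define R where "R n F F' \<longleftrightarrow>
      (\<exists>y. y \<notin> D \<and> (\<forall>s\<in>F. dist (s + y) s < (1/2) ^ n) \<and> F' = F \<union> (\<lambda>s. s + y) ` F)"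
    for n and F F' :: "'a set"
  have "\<exists>F. \<forall>n. (finite (F n) \<and> 0 \<in> F n) \<and> R n (F n) (F (Suc n))"
  proof (rule dependent_nat_choice)
    show "\<exists>F::'a set. finite F \<and> 0 \<in> F"
      by (intro exI[of _ "{0}"]) simp
    fix F :: "'a set" and n
    assume F: "finite F \<and> 0 \<in> F"
    then obtain y where "y \<notin> D" "\<forall>s\<in>F. dist (s + y) s < (1/2) ^ n"
      using step[of F "(1/2) ^ n"] by auto
    then have "R n F (F \<union> (\<lambda>s. s + y) ` F)"
      unfolding R_def by blast
    then show "\<exists>F'. (finite F' \<and> 0 \<in> F') \<and> R n F F'"
      using F by (intro exI[of _ "F \<union> (\<lambda>s. s + y) ` F"]) simp
  qed
  then obtain F where F: "\<And>n. 0 \<in> F n" and R: "\<And>n. R n (F n) (F (Suc n))"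
    by blast
  from R obtain x where x: "\<And>n. x n \<notin> D" "\<And>n s. s \<in> F n \<Longrightarrow> dist (s + x n) s < (1/2) ^ n"
      "\<And>n. F (Suc n) = F n \<union> (\<lambda>s. s + x n) ` F n"
    unfolding R_def by metis
  have mem: "subsum x n \<alpha> \<in> F n" for n \<alpha>
  proof (induction n)
    case 0
    show ?case
      using F by (simp add: subsum_def)
  next
    case (Suc n)
    then show ?case
      by (auto simp: subsum_Suc x(3))
  qed
  show thesis
    using that x(1) x(2)[OF mem] by blast
qed

text \<open>
  The hypothesis bounds each step of the partial sums uniformly in \<open>\<alpha>\<close> by a geometric series.
  Each partial sum depends on finitely many coordinates only and is therefore continuous, and a
  uniform limit preserves this.
\<close>

lemma subsum_limit:
  fixes x :: "nat \<Rightarrow> 'a::{topological_ab_group_add, complete_space}"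
  assumes x: "\<And>n \<alpha>. dist (subsum x n \<alpha> + x n) (subsum x n \<alpha>) < (1/2) ^ n"
  obtains f where "continuous_on UNIV f" "\<And>\<alpha>. (\<lambda>n. subsum x n \<alpha>) \<longlonglongrightarrow> f \<alpha>"
proof -
  \<comment> \<open>The exact value of the finite geometric sum is what the induction on \<open>n\<close> can carry along.\<close>
  have tail: "dist (subsum x m \<alpha>) (subsum x n \<alpha>) \<le> 2 * (1/2) ^ m - 2 * (1/2) ^ n"
    if "m \<le> n" for m n \<alpha>
    using that
  proof (induction n rule: dec_induct)
    case (step n)
    have "dist (subsum x n \<alpha>) (subsum x (Suc n) \<alpha>) \<le> (1/2) ^ n"
      using x[of n \<alpha>] by (simp add: subsum_Suc dist_commute less_imp_le)
    then show ?case
      using step dist_triangle[of "subsum x m \<alpha>" "subsum x (Suc n) \<alpha>" "subsum x n \<alpha>"] by simp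
  qed simp
  have "uniformly_Cauchy_on UNIV (subsum x)"
  proof (rule uniformly_Cauchy_onI')
    fix e :: real assume "e > 0"
    then obtain M where M: "(1/2) ^ M < e / 2"
      using real_arch_pow_inv[of "e / 2" "1 / 2"] by auto
    have "dist (subsum x m \<alpha>) (subsum x n \<alpha>) < e" if "m \<ge> M" "n > m" for m n \<alpha>
    proof -
      have "dist (subsum x m \<alpha>) (subsum x n \<alpha>) \<le> 2 * (1/2) ^ m"
        using tail[of m n \<alpha>] that by (smt (verit) less_imp_le zero_le_power divide_nonneg_nonneg)
      also have "(1/2::real) ^ m \<le> (1/2) ^ M"
        using that by (intro power_decreasing) auto
      finally show ?thesis
        using M by simp
    qed
    then show "\<exists>M. \<forall>\<alpha>\<in>UNIV. \<forall>m\<ge>M. \<forall>n>m. dist (subsum x m \<alpha>) (subsum x n \<alpha>) < e"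
      by blast
  qed
  then obtain f where f: "uniform_limit UNIV (subsum x) f sequentially"
    using Cauchy_uniformly_convergent uniformly_convergent_on_def by blast
  show thesis
  proof
    show "continuous_on UNIV f"
      using f by (rule uniform_limit_theorem[rotated]) (auto simp: continuous_on_subsum)
    show "(\<lambda>n. subsum x n \<alpha>) \<longlonglongrightarrow> f \<alpha>" for \<alpha>
      using f by (rule tendsto_uniform_limitI) simp
  qed
qed

section \<open>Differences of sets that are not Haar meager\<close>

theorem theorem2:
  fixes A :: "'a::{topological_ab_group_add, polish_space} set"
  assumes "A \<in> sets borel"
    and "\<not> haar_meager A"
  shows "0 \<in> interior {a - b | a b. a \<in> A \<and> b \<in> A}"
proof (rule ccontr)
  let ?D = "{a - b | a b. a \<in> A \<and> b \<in> A}"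
  assume "0 \<notin> interior ?D"
  then obtain x :: "nat \<Rightarrow> 'a" where notin: "\<And>n. x n \<notin> ?D"
    and x: "\<And>n \<alpha>. dist (subsum x n \<alpha> + x n) (subsum x n \<alpha>) < (1/2) ^ n"
    by (rule exists_rapidly_vanishing_sequence) blast
  from x obtain f where cont: "continuous_on UNIV f"
    and lim: "\<And>\<alpha>. (\<lambda>n. subsum x n \<alpha>) \<longlonglongrightarrow> f \<alpha>"
    by (rule subsum_limit) blast
  have f_flip: "f (flip n \<alpha>) - f \<alpha> = (if \<alpha> n then - x n else x n)" for n \<alpha>
  proof (rule LIMSEQ_unique)
    show "(\<lambda>m. subsum x m (flip n \<alpha>) - subsum x m \<alpha>) \<longlonglongrightarrow> f (flip n \<alpha>) - f \<alpha>"
      by (intro tendsto_diff lim)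
    show "(\<lambda>m. subsum x m (flip n \<alpha>) - subsum x m \<alpha>) \<longlonglongrightarrow> (if \<alpha> n then - x n else x n)"
      by (rule tendsto_eventually, rule eventually_mono[OF eventually_gt_at_top[of n]])
        (rule subsum_flip)
  qed
  have meager: "meager_in euclidean {\<alpha>. f \<alpha> \<in> (\<lambda>b. b + z) ` A}" (is "meager_in _ ?S") for z
  proof (rule ccontr)
    assume nonmeager: "\<not> meager_in euclidean ?S"
    have S: "?S = (\<lambda>\<alpha>. f \<alpha> - z) -` A"
      by (auto simp: image_iff) (metis diff_add_cancel)
    have "continuous_on UNIV (\<lambda>\<alpha>. f \<alpha> - z)"
      using cont by (intro continuous_intros)
    then have "?S \<in> sets borel"
      unfolding S using borel_measurable_continuous_onI assms(1) measurable_sets_borel by blast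
    then obtain n \<beta> where "\<beta> \<in> ?S" "flip n \<beta> \<in> ?S"
      using nonmeager by (rule nonmeager_imp_flip_pair)
    then obtain a b where ab: "a \<in> A" "b \<in> A" "f (flip n \<beta>) = a + z" "f \<beta> = b + z"
      by auto
    then have "a - b = (if \<beta> n then - x n else x n)"
      using f_flip[of n \<beta>] by simp
    \<comment> \<open>\<open>A - A\<close> is symmetric, so the sign does not matter.\<close>
    then have "x n = a - b \<or> x n = b - a"
      by (metis minus_diff_eq minus_minus)
    then show False
      using notin[of n] ab by blast
  qed
  \<comment> \<open>The Cantor space is given by its product topology, whereas a witness must carry a metric; any
    metric that induces the topology will do.\<close>
  obtain M d where Md: "Metric_space M d"
    and top: "Metric_space.mtopology M d = (euclidean :: (nat \<Rightarrow> bool) topology)"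
    using metrizable_space_cantor unfolding metrizable_space_def by metis
  define K where "K = metric (M, d)"
  have K: "mtopology_of K = euclidean"
    using Md top by (simp add: K_def mtopology_of_def Metric_space.mspace_metric
        Metric_space.mdist_metric)
  then have mspace: "mspace K = UNIV"
    by (metis topspace_euclidean topspace_mtopology_of)
  have "haar_meager A"
    by (rule haar_meagerI[OF assms(1) order_refl, of K f])
      (use cont meager in \<open>simp_all add: K mspace compact_space_cantor\<close>)
  with assms(2) show False ..
qed

end
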